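(* Let $n\ge 1$ and $0\le k\le n-1$ be integers. There is no function $u\in\mathcal{C}^3(\mathbb{R}^n)$ satisfying $$Q_k(Du,D^2u)=\frac{1}{\sqrt{1+|Du|^2}}\quad\text{in }\mathbb{R}^n$$ and such that both of the following hold: (1) at every point the principal curvatures of the graph of $u$ lie in $\Gamma_{k+1}$; (2) $u(x)=o(|x|)$ as $|x|\to\infty$.
   Context: For $\lambda\in\mathbb{R}^n$, $S_k(\lambda)=\sum_{1\le i_1<\dots<i_k\le n}\lambda_{i_1}\cdots\lambda_{i_k}$ is the $k$-th elementary symmetric polynomial, with $S_0=1$. $\Gamma_{k+1}=\{\lambda\in\mathbb{R}^n: S_l(\lambda)>0,\ l=0,\dots,k+1\}$ and $Q_k=S_{k+1}/S_k$ on $\Gamma_{k+1}$. For a function $u$, the principal curvatures of its graph are the eigenvalues of the symmetric matrix $$A_{ij}=\frac1w\left(u_{ij}-\frac{u_iu_mu_{mj}}{w(1+w)}-\frac{u_ju_mu_{mi}}{w(1+w)}+\frac{u_iu_ju_mu_lu_{ml}}{w^2(1+w)^2}\right),\quad w=\sqrt{1+|Du|^2}$$ (summation over repeated indices $m,l$; subscripts on $u$ denote partial derivatives). $Q_k(Du,D^2u)$ denotes $Q_k$ evaluated at these eigenvalues. The equation says that the graph of $u$ is a translating soliton (in direction $e_{n+1}$, with unit speed) of the $Q_k$-flow. *)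

theory Defs
  imports "HOL-Analysis.Analysis" "HOL-Library.Landau_Symbols"
begin

definition elem_sym :: "nat \<Rightarrow> real ^ 'n \<Rightarrow> real" where
  "elem_sym k \<kappa> = (\<Sum>I | card I = k. \<Prod>i\<in>I. \<kappa> $ i)"

definition Gamma_cone :: "nat \<Rightarrow> (real ^ 'n) set" where
  "Gamma_cone m = {\<kappa>. \<forall>l\<le>m. elem_sym l \<kappa> > 0}"

definition Q_quot :: "nat \<Rightarrow> real ^ 'n \<Rightarrow> real" where
  "Q_quot k \<kappa> = elem_sym (Suc k) \<kappa> / elem_sym k \<kappa>"

definition partial_deriv :: "'n \<Rightarrow> (real ^ 'n \<Rightarrow> real) \<Rightarrow> real ^ 'n \<Rightarrow> real" where
  "partial_deriv i u x = frechet_derivative u (at x) (axis i 1)"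

text \<open>Requiring Frechet differentiability at each stage, rather than mere existence of the
  partial derivatives, ensures that \<^const>\<open>partial_deriv\<close> is meaningful; since the partial
  derivatives are continuous, this is the usual class of m times continuously differentiable
  functions on the whole space.\<close>

primrec C_diff :: "nat \<Rightarrow> (real ^ 'n \<Rightarrow> real) \<Rightarrow> bool" where
  "C_diff 0 u \<longleftrightarrow> continuous_on UNIV u"
| "C_diff (Suc m) u \<longleftrightarrow>
     (\<forall>x. u differentiable (at x)) \<and> (\<forall>i. C_diff m (partial_deriv i u))"

definition grad :: "(real ^ 'n \<Rightarrow> real) \<Rightarrow> real ^ 'n \<Rightarrow> real ^ 'n" where
  "grad u x = (\<chi> i. partial_deriv i u x)"

definition hess :: "(real ^ 'n \<Rightarrow> real) \<Rightarrow> real ^ 'n \<Rightarrow> real ^ 'n ^ 'n" where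
  "hess u x = (\<chi> i j. partial_deriv j (partial_deriv i u) x)"

definition curvature_matrix :: "real ^ 'n \<Rightarrow> real ^ 'n ^ 'n \<Rightarrow> real ^ 'n ^ 'n" where
  "curvature_matrix p H =
     (let w = sqrt (1 + (norm p)\<^sup>2) in
      \<chi> i j. 1 / w *
        (H $ i $ j
         - (\<Sum>m\<in>UNIV. p $ i * p $ m * H $ m $ j) / (w * (1 + w))
         - (\<Sum>m\<in>UNIV. p $ j * p $ m * H $ m $ i) / (w * (1 + w))
         + (\<Sum>m\<in>UNIV. \<Sum>l\<in>UNIV. p $ i * p $ j * p $ m * p $ l * H $ m $ l)
             / (w\<^sup>2 * (1 + w)\<^sup>2)))"

text \<open>The eigenvalues, listed with algebraic multiplicity. Such a vector exists for every
  symmetric matrix, and it is unique up to the order of its entries, on which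
  \<^const>\<open>elem_sym\<close>, \<^const>\<open>Gamma_cone\<close> and \<^const>\<open>Q_quot\<close> do not depend.
  The value is meaningless if the characteristic polynomial does not split over the reals.\<close>

definition eigenvalues :: "real ^ 'n ^ 'n \<Rightarrow> real ^ 'n" where
  "eigenvalues A = (SOME \<kappa>. \<forall>t. det (mat t - A) = (\<Prod>i\<in>UNIV. t - \<kappa> $ i))"

definition principal_curvatures :: "real ^ 'n \<Rightarrow> real ^ 'n ^ 'n \<Rightarrow> real ^ 'n" where
  "principal_curvatures p H = eigenvalues (curvature_matrix p H)"

definition Q_op :: "nat \<Rightarrow> real ^ 'n \<Rightarrow> real ^ 'n ^ 'n \<Rightarrow> real" where
  "Q_op k p H = Q_quot k (principal_curvatures p H)"

end

theory Submission
  imports Defs "HOL-Computational_Algebra.Fundamental_Theorem_Algebra"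
begin

text \<open>Since \<open>u\<close> grows sublinearly, \<open>u - \<epsilon> sqrt (1 + |x|\<^sup>2)\<close> attains a maximum, and there the
  Hessian of \<open>u\<close> is bounded above by \<open>\<epsilon>\<close>. Writing the curvature matrix as \<open>M H M / w\<close> with
  \<open>M = I - p p\<^sup>T / (w (1 + w))\<close>, whose columns have norm at most 2, its trace is at most
  \<open>4 n \<epsilon> / w\<close> at that point. On the cone, Newton's inequalities make \<open>S\<^sub>j\<^sub>+\<^sub>1 / S\<^sub>j\<close> decreasing
  in \<open>j\<close>, so \<open>Q\<^sub>k \<le> S\<^sub>1\<close>, which is the trace. For small \<open>\<epsilon>\<close> this contradicts \<open>Q\<^sub>k = 1 / w\<close>.\<close>

section \<open>Newton's inequalities\<close>

text \<open>The case \<open>c = 0\<close> makes the zero polynomial real-rooted, so that the class is closed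
  under differentiation.\<close>

definition real_rooted :: "real poly \<Rightarrow> bool" where
  "real_rooted p \<longleftrightarrow> (\<exists>c rs. p = smult c (\<Prod>r\<leftarrow>rs. [:- r, 1:]))"

text \<open>At a nonreal z the quotient q'(z)/q(z) is the sum of the 1/(z - r), and each term has
  imaginary part -Im z / |z - r|^2. All these parts have the same sign, so nothing cancels. An empty
  list would give q = 1, whose derivative vanishes everywhere.\<close>

lemma poly_pderiv_real_roots_nonreal:
  fixes rs :: "real list" and z :: complex
  defines "q \<equiv> \<Prod>r\<leftarrow>rs. [:- complex_of_real r, 1:]"
  assumes z: "Im z \<noteq> 0" and "rs \<noteq> []"
  shows "poly (pderiv q) z \<noteq> 0"
proof -
  have nz: "poly (\<Prod>r\<leftarrow>rs. [:- complex_of_real r, 1:]) z \<noteq> 0" for rs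
  proof (induction rs)
    case (Cons a rs)
    have "z - of_real a \<noteq> 0" using z by (auto simp: complex_eq_iff)
    with Cons show ?case by (simp flip: left_diff_distrib)
  qed simp
  have sum: "poly (pderiv (\<Prod>r\<leftarrow>rs. [:- complex_of_real r, 1:])) z
      = poly (\<Prod>r\<leftarrow>rs. [:- complex_of_real r, 1:]) z * (\<Sum>r\<leftarrow>rs. 1 / (z - of_real r))" for rs
  proof (induction rs)
    case (Cons a rs)
    have "z - of_real a \<noteq> 0" using z by (auto simp: complex_eq_iff)
    then show ?case
      by (simp only: list.map prod_list.Cons pderiv_mult poly_add poly_mult Cons.IH)
        (simp add: pderiv_pCons field_simps)
  qed simp
  \<comment> \<open>Multiplying by Im z treats both half-planes at once. The weak inequality is
    carried along because the tail in the induction may be empty.\<close>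
  have neg: "Im (\<Sum>r\<leftarrow>rs. 1 / (z - of_real r)) * Im z \<le> 0"
    "rs \<noteq> [] \<Longrightarrow> Im (\<Sum>r\<leftarrow>rs. 1 / (z - of_real r)) * Im z < 0" for rs :: "real list"
  proof (induction rs)
    case (Cons a rs)
    have "Im (1 / (z - of_real a)) * Im z = - (Im z)\<^sup>2 / (cmod (z - of_real a))\<^sup>2"
      by (simp add: Im_divide cmod_power2) (simp add: power2_eq_square)
    also have "\<dots> < 0"
      using z by (auto simp: complex_eq_iff)
    finally have "Im (1 / (z - of_real a)) * Im z < 0" .
    with Cons show "Im (\<Sum>r\<leftarrow>a # rs. 1 / (z - of_real r)) * Im z \<le> 0"
      "Im (\<Sum>r\<leftarrow>a # rs. 1 / (z - of_real r)) * Im z < 0"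
      by (auto simp: algebra_simps simp del: Im_divide)
  qed auto
  show ?thesis
    using neg(2)[OF \<open>rs \<noteq> []\<close>] nz[of rs] unfolding q_def sum by auto
qed

lemma map_poly_of_real_smult_prod:
  "map_poly complex_of_real (smult c (\<Prod>r\<leftarrow>rs. [:- r, 1:]))
     = smult (of_real c) (\<Prod>r\<leftarrow>rs. [:- of_real r, 1:])"
proof -
  have "map_poly complex_of_real (p * q) = map_poly of_real p * map_poly of_real q" for p q
    by (rule poly_eqI) (simp add: coeff_map_poly coeff_mult)
  then have "map_poly complex_of_real (\<Prod>r\<leftarrow>rs. [:- r, 1:]) = (\<Prod>r\<leftarrow>rs. [:- of_real r, 1:])"
    by (induction rs) (simp_all add: map_poly_pCons del: mult_pCons_left)
  then show ?thesis
    by (simp add: map_poly_smult)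
qed

text \<open>Gauss--Lucas: the logarithmic derivative of a polynomial with real roots has
  imaginary part of fixed sign in each of the two open half-planes.\<close>

lemma real_rooted_pderiv:
  assumes "real_rooted p"
  shows "real_rooted (pderiv p)"
proof (cases "pderiv p = 0")
  case True
  then show ?thesis unfolding real_rooted_def by (intro exI[of _ 0]) simp
next
  case False
  obtain c rs where p: "p = smult c (\<Prod>r\<leftarrow>rs. [:- r, 1:])"
    using assms by (auto simp: real_rooted_def)
  define cp where "cp = map_poly complex_of_real (pderiv p)"
  have ne: "c \<noteq> 0" "rs \<noteq> []"
    using False by (auto simp: p)
  have "cp = pderiv (map_poly complex_of_real p)"
    unfolding cp_def by (rule poly_eqI) (simp add: coeff_map_poly coeff_pderiv)
  then have cp: "cp = smult (of_real c) (pderiv (\<Prod>r\<leftarrow>rs. [:- complex_of_real r, 1:]))"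
    unfolding p map_poly_of_real_smult_prod by (simp add: pderiv_smult)
  \<comment> \<open>These are the complex roots of the derivative with multiplicity. Once they are
    known to be real, the splitting over the complex numbers descends to the reals by comparing
    coefficients.\<close>
  obtain zs where zs: "mset zs = proots cp"
    using ex_mset by blast
  have "cp \<noteq> 0"
    using False by (simp add: cp_def map_poly_eq_0_iff)
  have real: "z \<in> \<real>" if "z \<in> set zs" for z
  proof -
    have "z \<in># proots cp"
      using that zs by (metis set_mset_mset)
    then have "poly cp z = 0"
      using \<open>cp \<noteq> 0\<close> by simp
    then show ?thesis
      using poly_pderiv_real_roots_nonreal[of z rs] ne by (auto simp: cp complex_is_Real_iff)
  qed
  then have "zs = map complex_of_real (map Re zs)"
    by (intro nth_equalityI) (auto simp: of_real_Re)
  have "lead_coeff cp = of_real (lead_coeff (pderiv p))"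
    by (simp add: cp_def coeff_map_poly degree_map_poly)
  have "cp = smult (lead_coeff cp) (\<Prod>z\<leftarrow>zs. [:- z, 1:])"
    using complex_poly_decompose_multiset[of cp] by (metis mset_map prod_mset_prod_list zs)
  also have "\<dots> = map_poly of_real (smult (lead_coeff (pderiv p)) (\<Prod>r\<leftarrow>map Re zs. [:- r, 1:]))"
    unfolding map_poly_of_real_smult_prod \<open>lead_coeff cp = _\<close>
    by (subst \<open>zs = _\<close>) (simp add: o_def)
  finally have eq: "map_poly complex_of_real (pderiv p)
      = map_poly of_real (smult (lead_coeff (pderiv p)) (\<Prod>r\<leftarrow>map Re zs. [:- r, 1:]))"
    unfolding cp_def .
  have "pderiv p = smult (lead_coeff (pderiv p)) (\<Prod>r\<leftarrow>map Re zs. [:- r, 1:])"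
  proof (rule poly_eqI)
    fix n
    show "coeff (pderiv p) n = coeff (smult (lead_coeff (pderiv p)) (\<Prod>r\<leftarrow>map Re zs. [:- r, 1:])) n"
      using arg_cong[OF eq, of "\<lambda>q. coeff q n"]
      unfolding coeff_map_poly[of complex_of_real, OF of_real_0] of_real_eq_iff .
  qed
  then show ?thesis unfolding real_rooted_def by blast
qed

lemma real_rooted_higher_pderiv: "real_rooted p \<Longrightarrow> real_rooted ((pderiv ^^ m) p)"
  by (induction m) (auto intro: real_rooted_pderiv)

text \<open>Adding a root a to q, so that p = (X - a) q, gives p'^2 - p p'' = (x - a)^2 (q'^2 - q
  q'') + q^2, so nonnegativity is inherited root by root. The leading constant only contributes the
  factor c^2.\<close>

lemma laguerre_inequality:
  assumes "real_rooted p"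
  shows "poly p x * poly (pderiv (pderiv p)) x \<le> (poly (pderiv p) x)\<^sup>2"
proof -
  have *: "poly p x * poly (pderiv (pderiv p)) x \<le> (poly (pderiv p) x)\<^sup>2"
    if "p = (\<Prod>r\<leftarrow>rs. [:- r, 1:])" for p and rs :: "real list"
    using that
  proof (induction rs arbitrary: p)
    case (Cons a rs)
    define q where "q = (\<Prod>r\<leftarrow>rs. [:- r, 1:])"
    have p: "p = [:- a, 1:] * q" by (simp add: Cons.prems q_def)
    have d: "pderiv p = q + [:- a, 1:] * pderiv q" "pderiv (pderiv p) = 2 * pderiv q + [:- a, 1:] * pderiv (pderiv q)"
      unfolding p
      by (simp_all only: pderiv_mult pderiv_add) (simp_all add: pderiv_pCons)
    have "(x - a)\<^sup>2 * ((poly (pderiv q) x)\<^sup>2 - poly q x * poly (pderiv (pderiv q)) x) + (poly q x)\<^sup>2 \<ge> 0"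
      using Cons.IH[OF q_def] by simp
    then show ?case
      unfolding d(2) unfolding d(1) unfolding p by (simp add: algebra_simps power2_eq_square)
  qed simp
  obtain c rs where p: "p = smult c (\<Prod>r\<leftarrow>rs. [:- r, 1:])"
    using assms by (auto simp: real_rooted_def)
  have "c\<^sup>2 * (poly (\<Prod>r\<leftarrow>rs. [:- r, 1:]) x * poly (pderiv (pderiv (\<Prod>r\<leftarrow>rs. [:- r, 1:]))) x)
      \<le> c\<^sup>2 * (poly (pderiv (\<Prod>r\<leftarrow>rs. [:- r, 1:])) x)\<^sup>2"
    by (rule mult_left_mono[OF *]) auto
  then show ?thesis
    by (simp add: p pderiv_smult algebra_simps power2_eq_square)
qed

lemma real_rooted_const: "real_rooted [:c:]"
  unfolding real_rooted_def by (intro exI[of _ c] exI[of _ "[]"]) simp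

lemma real_rooted_mult:
  assumes "real_rooted p" "real_rooted q"
  shows "real_rooted (p * q)"
proof -
  obtain c rs d ss where "p = smult c (\<Prod>r\<leftarrow>rs. [:- r, 1:])" "q = smult d (\<Prod>r\<leftarrow>ss. [:- r, 1:])"
    using assms by (auto simp: real_rooted_def)
  then have "p * q = smult (c * d) (\<Prod>r\<leftarrow>rs @ ss. [:- r, 1:])"
    by (simp add: mult_ac)
  then show ?thesis unfolding real_rooted_def by blast
qed

lemma real_rooted_linear: "real_rooted [:1, a:]"
proof (cases "a = 0")
  case False
  then have "[:1, a:] = smult a (\<Prod>r\<leftarrow>[- 1 / a]. [:- r, 1:])" by simp
  then show ?thesis unfolding real_rooted_def by blast
qed (simp add: real_rooted_const)

lemma real_rooted_prod: "(\<And>i. i \<in> I \<Longrightarrow> real_rooted (f i)) \<Longrightarrow> real_rooted (\<Prod>i\<in>I. f i)"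
  by (induction I rule: infinite_finite_induct)
     (auto intro: real_rooted_mult simp: real_rooted_linear[of 0, simplified] one_pCons real_rooted_const)

text \<open>Expanding the product selects a set X of indices that contribute their linear term.
  Factors 1 + t X instead of X - t give the elementary symmetric functions without signs or reversal
  of the index.\<close>

lemma coeff_prod_eq_elem_sym:
  fixes \<kappa> :: "real ^ 'n"
  shows "coeff (\<Prod>i\<in>UNIV. [:1, \<kappa> $ i:]) k = elem_sym k \<kappa>"
proof -
  have "(\<Prod>i\<in>UNIV. [:1, \<kappa> $ i:]) = (\<Prod>i\<in>UNIV. [:0, \<kappa> $ i:] + [:1:])" by simp
  also have "\<dots> = (\<Sum>X\<in>UNIV. monom (\<Prod>i\<in>X. \<kappa> $ i) (card X))"
  proof -
    have "(\<Prod>i\<in>X. [:0, \<kappa> $ i:]) = monom (\<Prod>i\<in>X. \<kappa> $ i) (card X)" for X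
      by (induction X rule: infinite_finite_induct)
        (auto simp: monom_Suc monom_0 mult_monom smult_monom one_pCons simp flip: smult_monom)
    then show ?thesis
      by (subst prod_add) (auto simp: one_pCons[symmetric])
  qed
  finally show ?thesis
    by (simp add: coeff_sum elem_sym_def sum.If_cases Collect_conj_eq[symmetric] cong: if_cong)
qed

text \<open>This is Laguerre's inequality at 0 for the m-th derivative of the generating function,
  whose three lowest coefficients are multiples of S_m, S_(m+1) and S_(m+2). The factors m + 2 and m
  + 1 are what remains of the factorials. No sign condition on the entries is involved, and the
  constants do not depend on the dimension.\<close>

lemma newton_inequality:
  fixes \<kappa> :: "real ^ 'n"
  shows "real (m + 2) * (elem_sym m \<kappa> * elem_sym (m + 2) \<kappa>) \<le> real (m + 1) * (elem_sym (m + 1) \<kappa>)\<^sup>2"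
proof -
  define p where "p = (\<Prod>i\<in>UNIV. [:1, \<kappa> $ i:])"
  define q where "q = (pderiv ^^ m) p"
  have "real_rooted q"
    unfolding q_def p_def by (intro real_rooted_higher_pderiv real_rooted_prod real_rooted_linear)
  from laguerre_inequality[OF this, of 0]
  have "coeff q 0 * (2 * coeff q 2) \<le> (coeff q 1)\<^sup>2"
    by (simp add: poly_0_coeff_0 coeff_pderiv numeral_2_eq_2)
  moreover have "coeff q j * fact j = fact (m + j) * elem_sym (m + j) \<kappa>" for j
    by (simp add: q_def coeff_higher_pderiv p_def coeff_prod_eq_elem_sym pochhammer_fact
        pochhammer_product' add.commute)
  from this[of 0] this[of 1] this[of 2]
  have "coeff q 0 = fact m * elem_sym m \<kappa>" "coeff q 1 = fact m * real (m + 1) * elem_sym (m + 1) \<kappa>"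
    "2 * coeff q 2 = fact m * real (m + 1) * real (m + 2) * elem_sym (m + 2) \<kappa>"
    by (simp_all add: algebra_simps)
  ultimately have "((fact m)\<^sup>2 * real (m + 1)) * (real (m + 2) * (elem_sym m \<kappa> * elem_sym (m + 2) \<kappa>))
      \<le> ((fact m)\<^sup>2 * real (m + 1)) * (real (m + 1) * (elem_sym (m + 1) \<kappa>)\<^sup>2)"
    by (simp add: power_mult_distrib algebra_simps power2_eq_square)
  then show ?thesis
    by (subst (asm) mult_le_cancel_left_pos) auto
qed

lemma elem_sym_0: "elem_sym 0 \<kappa> = 1"
  by (simp add: elem_sym_def)

lemma elem_sym_1: "elem_sym 1 \<kappa> = (\<Sum>i\<in>UNIV. \<kappa> $ i)"
proof -
  have "{I :: 'a set. card I = 1} = (\<lambda>i. {i}) ` UNIV"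
    by (auto simp: card_1_singleton_iff)
  then show ?thesis
    by (simp add: elem_sym_def sum.reindex)
qed

lemma Q_quot_le_sum:
  assumes "\<kappa> \<in> Gamma_cone (k + 1)"
  shows "Q_quot k \<kappa> \<le> (\<Sum>i\<in>UNIV. \<kappa> $ i)"
  using assms
proof (induction k)
  case 0
  then show ?case by (simp add: Q_quot_def elem_sym_0 elem_sym_1[simplified])
next
  case (Suc k)
  have pos: "elem_sym l \<kappa> > 0" if "l \<le> k + 2" for l
    using Suc.prems that by (auto simp: Gamma_cone_def)
  \<comment> \<open>Lowering the factor k + 2 to k + 1 requires S_k S_(k+2) to be nonnegative, which
    the cone provides. The common factor then cancels and leaves log-concavity, that is, Q_(k+1) is
    at most Q_k. The induction ends at Q_0 = S_1.\<close>
  have "(real k + 1) * (elem_sym k \<kappa> * elem_sym (k + 2) \<kappa>)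
      \<le> real (k + 2) * (elem_sym k \<kappa> * elem_sym (k + 2) \<kappa>)"
    using pos[of k] pos[of "k + 2"] by (intro mult_right_mono) auto
  also have "\<dots> \<le> (real k + 1) * (elem_sym (k + 1) \<kappa>)\<^sup>2"
    using newton_inequality[of k \<kappa>] by (simp add: add.commute)
  finally have "elem_sym k \<kappa> * elem_sym (k + 2) \<kappa> \<le> (elem_sym (k + 1) \<kappa>)\<^sup>2"
    by (simp add: mult_le_cancel_left_pos)
  then have "Q_quot (Suc k) \<kappa> \<le> Q_quot k \<kappa>"
    using pos[of k] pos[of "k + 1"] by (simp add: Q_quot_def field_simps power2_eq_square)
  also have "\<dots> \<le> (\<Sum>i\<in>UNIV. \<kappa> $ i)"
    using Suc.prems by (intro Suc.IH) (auto simp: Gamma_cone_def)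
  finally show ?case .
qed

section \<open>Diagonalization of symmetric matrices\<close>

text \<open>The quadratic form of f attains its maximum M on the unit sphere of S, and a maximizer x
  is an eigenvector with eigenvalue M.\<close>

lemma self_adjoint_has_eigenvector:
  fixes f :: "'a::euclidean_space \<Rightarrow> 'a"
  assumes f: "linear f" and sa: "\<And>x y. f x \<bullet> y = x \<bullet> f y"
    and S: "subspace S" "f ` S \<subseteq> S" "S \<noteq> {0}"
  obtains x c where "x \<in> S" "norm x = 1" "f x = c *\<^sub>R x"
proof -
  interpret linear f by fact
  obtain z where z: "z \<in> S" "z \<noteq> 0" using S(1,3) subspace_0 by blast
  have ne: "S \<inter> sphere 0 1 \<noteq> {}"
  proof -
    have "z /\<^sub>R norm z \<in> S \<inter> sphere 0 1" using z S(1) by (simp add: subspace_scale)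
    then show ?thesis by blast
  qed
  have "compact (S \<inter> sphere 0 1)"
    by (intro closed_Int_compact closed_subspace S compact_sphere)
  moreover have "continuous_on (S \<inter> sphere 0 1) (\<lambda>x. x \<bullet> f x)"
    by (intro continuous_intros linear_continuous_on) (use f linear_conv_bounded_linear in blast)
  ultimately obtain x where x: "x \<in> S" "norm x = 1" and "\<forall>y\<in>S \<inter> sphere 0 1. y \<bullet> f y \<le> x \<bullet> f x"
    using ne continuous_attains_sup[of "S \<inter> sphere 0 1" "\<lambda>x. x \<bullet> f x"] by auto
  then have max1: "y \<bullet> f y \<le> x \<bullet> f x" if "y \<in> S" "norm y = 1" for y using that by auto
  define M where "M = x \<bullet> f x"
  have max: "y \<bullet> f y \<le> M * (y \<bullet> y)" if "y \<in> S" for y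
  proof (cases "y = 0")
    case False
    have "(y /\<^sub>R norm y) \<bullet> f (y /\<^sub>R norm y) \<le> M"
      unfolding M_def using that False S(1) by (intro max1) (auto simp: subspace_scale)
    then have "(y \<bullet> f y) / (norm y)\<^sup>2 \<le> M"
      by (simp add: scaleR power2_eq_square field_simps)
    with False show ?thesis
      by (simp add: divide_le_eq power2_norm_eq_inner)
  qed (simp add: zero)
  \<comment> \<open>The residual y lies in S because S is invariant, so x + t y is an admissible
    competitor. Its first-order gain in t is 2 t |y|^2, which maximality forbids unless y =
    0.\<close>
  define y where "y = f x - M *\<^sub>R x"
  have y: "y \<in> S" unfolding y_def using x S by (intro subspace_diff subspace_scale) auto
  have quad: "2 * t * (y \<bullet> y) \<le> t\<^sup>2 * (M * (y \<bullet> y) - y \<bullet> f y)" for t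
  proof -
    have "x + t *\<^sub>R y \<in> S" using x y S by (intro subspace_add subspace_scale) auto
    from max[OF this]
    have "x \<bullet> f x + 2 * t * (y \<bullet> f x) + t\<^sup>2 * (y \<bullet> f y) \<le> M * (x \<bullet> x + 2 * t * (y \<bullet> x) + t\<^sup>2 * (y \<bullet> y))"
      using sa[of x y]
      by (simp add: add scaleR inner_add_left inner_add_right inner_commute algebra_simps power2_eq_square)
    moreover have "x \<bullet> x = 1" using x by (simp add: norm_eq_1)
    ultimately show ?thesis unfolding M_def[symmetric]
      by (simp add: y_def inner_diff_right algebra_simps)
  qed
  have "y \<bullet> y = 0"
  proof (rule ccontr)
    assume "y \<bullet> y \<noteq> 0"
    then have pos: "y \<bullet> y > 0" by simp
    define C where "C = \<bar>M * (y \<bullet> y) - y \<bullet> f y\<bar> + 1"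
    \<comment> \<open>With this t the quadratic term is at most t |y|^2, only half of the linear
      term. The added 1 in C keeps the denominator positive.\<close>
    define t where "t = (y \<bullet> y) / C"
    have C: "C > 0" "M * (y \<bullet> y) - y \<bullet> f y \<le> C" by (auto simp: C_def)
    have t: "t > 0" using pos C by (simp add: t_def)
    have "2 * t * (y \<bullet> y) \<le> t\<^sup>2 * C"
      using quad[of t] mult_left_mono[OF C(2) zero_le_power2[of t]] by linarith
    also have "\<dots> = t * (y \<bullet> y)" using C by (simp add: t_def power2_eq_square)
    finally show False using t pos by simp
  qed
  then have "f x = M *\<^sub>R x" by (simp add: y_def)
  with x that show ?thesis by blast
qed

text \<open>One eigenvector x is split off at a time. By self-adjointness f preserves the orthogonal
  complement of x in S, which has smaller dimension; the formulation for invariant subspaces lets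
  the induction continue there.\<close>

theorem self_adjoint_orthonormal_eigenbasis:
  fixes f :: "'a::euclidean_space \<Rightarrow> 'a"
  assumes f: "linear f" and sa: "\<And>x y. f x \<bullet> y = x \<bullet> f y"
    and S: "subspace S" "f ` S \<subseteq> S"
  obtains B where "B \<subseteq> S" "span B = S" "pairwise orthogonal B"
    "\<And>b. b \<in> B \<Longrightarrow> norm b = 1" "\<And>b. b \<in> B \<Longrightarrow> \<exists>c. f b = c *\<^sub>R b"
proof -
  have "\<exists>B. B \<subseteq> S \<and> span B = S \<and> pairwise orthogonal B \<and> (\<forall>b\<in>B. norm b = 1 \<and> (\<exists>c. f b = c *\<^sub>R b))"
    using S
  proof (induction "dim S" arbitrary: S rule: less_induct)
    case less
    show ?case
    proof (cases "S = {0}")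
      case True
      then show ?thesis by (intro exI[of _ "{}"]) auto
    next
      case False
      from self_adjoint_has_eigenvector[OF f sa less.prems(1,2) this]
      obtain x c where x: "x \<in> S" "norm x = 1" "f x = c *\<^sub>R x" by blast
      define T where "T = {y \<in> S. x \<bullet> y = 0}"
      have T: "subspace T"
        using less.prems(1) by (auto simp: T_def subspace_def inner_add_right)
      have "x \<notin> T" using x by (auto simp: T_def)
      moreover have "T \<subseteq> S" by (auto simp: T_def)
      ultimately have "T \<subset> S" using x by blast
      then have "dim T < dim S"
        using T less.prems(1) by (metis dim_psubset span_eq_iff)
      moreover have "f ` T \<subseteq> T"
        using less.prems(2) x(3) by (auto simp: T_def sa[symmetric])
      ultimately obtain B where B: "B \<subseteq> T" "span B = T" "pairwise orthogonal B"
        "\<forall>b\<in>B. norm b = 1 \<and> (\<exists>c. f b = c *\<^sub>R b)"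
        using less.hyps T by blast
      have "span (insert x B) = S"
      proof
        show "span (insert x B) \<subseteq> S"
          using x B \<open>T \<subset> S\<close> less.prems(1) by (intro span_minimal) auto
        show "S \<subseteq> span (insert x B)"
        proof
          fix v assume "v \<in> S"
          have "x \<bullet> x = 1" using x by (simp add: norm_eq_1)
          then have "v - (x \<bullet> v) *\<^sub>R x \<in> span B"
            using \<open>v \<in> S\<close> x less.prems(1) unfolding B(2) T_def
            by (auto simp: inner_diff_right intro!: subspace_diff subspace_scale)
          then show "v \<in> span (insert x B)" by (auto simp: span_insert)
        qed
      qed
      moreover have "pairwise orthogonal (insert x B)"
        using B(1,3) by (auto simp: pairwise_insert T_def orthogonal_def inner_commute)
      ultimately show ?thesis
        using x B \<open>T \<subset> S\<close> by (intro exI[of _ "insert x B"]) auto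
    qed
  qed
  then show ?thesis using that by blast
qed

theorem symmetric_matrix_diagonalization:
  fixes A :: "real ^ 'n ^ 'n"
  assumes "transpose A = A"
  obtains P :: "real ^ 'n ^ 'n" and d :: "real ^ 'n" where "orthogonal_matrix P"
    "A = P ** (\<chi> i j. if i = j then d $ i else 0) ** transpose P"
proof -
  have sa: "(A *v x) \<bullet> y = x \<bullet> (A *v y)" for x y
    using assms by (metis dot_lmul_matrix transpose_matrix_vector)
  obtain B where B: "span B = UNIV" "pairwise orthogonal B"
    "\<And>b. b \<in> B \<Longrightarrow> norm b = 1" "\<And>b. b \<in> B \<Longrightarrow> \<exists>c. A *v b = c *\<^sub>R b"
    using self_adjoint_orthonormal_eigenbasis[OF matrix_vector_mul_linear sa subspace_UNIV] by auto
  have "0 \<notin> B"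
    using B(3)[of 0] by auto
  then have "independent B"
    using B by (intro pairwise_orthogonal_independent)
  then have "card B = CARD('n)" "finite B"
    using B(1) by (auto simp: dim_UNIV independent_imp_finite dest: dim_eq_card_independent)
       (metis DIM_cart DIM_real dim_UNIV dim_span dim_eq_card_independent mult.right_neutral)
  \<comment> \<open>There are exactly as many eigenvectors as indices, so the basis can be indexed
    by \<open>'n\<close> and used as the columns of a square matrix.\<close>
  then obtain e :: "'n \<Rightarrow> real ^ 'n" where e: "bij_betw e UNIV B"
    using finite_same_card_bij[of "UNIV :: 'n set" B] by auto
  have ortho: "e i \<bullet> e j = (if i = j then 1 else 0)" for i j
  proof (cases "i = j")
    case True
    have "norm (e i) = 1" using e B(3) by (auto simp: bij_betw_def)
    with True show ?thesis by (simp add: norm_eq_1)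
  next
    case False
    then have "e i \<noteq> e j" "e i \<in> B" "e j \<in> B" using e by (auto simp: bij_betw_def inj_def)
    with B(2) False show ?thesis by (auto simp: pairwise_def orthogonal_def)
  qed
  have "\<exists>c. A *v e i = c *\<^sub>R e i" for i
    using B(4) e by (auto simp: bij_betw_def)
  then obtain c where c: "\<And>i. A *v e i = c i *\<^sub>R e i" by metis
  define d :: "real ^ 'n" where "d = (\<chi> i. c i)"
  have d: "A *v e i = (d $ i) *\<^sub>R e i" for i
    by (simp add: c d_def)
  define P where "P = (\<chi> i j. e j $ i)"
  have P: "transpose P ** P = mat 1"
    using ortho by (simp add: P_def vec_eq_iff matrix_matrix_mult_def transpose_def mat_def inner_vec_def)
  then have oP: "orthogonal_matrix P" by (simp add: orthogonal_matrix)
  have "A ** P = P ** (\<chi> i j. if i = j then d $ i else 0)"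
  proof -
    have "(\<Sum>k\<in>UNIV. A $ i $ k * e j $ k) = d $ j * e j $ i" for i j
      using d[of j] by (simp add: vec_eq_iff matrix_vector_mult_def)
    then show ?thesis
      by (simp add: P_def vec_eq_iff matrix_matrix_mult_def if_distrib cong: if_cong)
  qed
  then have "A ** P ** transpose P = P ** (\<chi> i j. if i = j then d $ i else 0) ** transpose P"
    by simp
  moreover have "A ** P ** transpose P = A"
    using oP by (simp add: orthogonal_matrix_def flip: matrix_mul_assoc)
  ultimately show ?thesis by (intro that[OF oP, of d]) simp
qed

text \<open>Substituting t = 1/s and clearing denominators turns the two products into the
  generating functions of -a and -b for s different from 0. Agreeing at infinitely many points,
  these polynomials are equal, and their coefficients of degree 1 give the sums.\<close>

lemma sum_eq_if_prod_linear_eq: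
  fixes a b :: "real ^ 'n"
  assumes "\<And>t. (\<Prod>i\<in>UNIV. t - a $ i) = (\<Prod>i\<in>UNIV. t - b $ i)"
  shows "(\<Sum>i\<in>UNIV. a $ i) = (\<Sum>i\<in>UNIV. b $ i)"
proof -
  have "poly (\<Prod>i\<in>UNIV. [:1, - a $ i:]) s = poly (\<Prod>i\<in>UNIV. [:1, - b $ i:]) s"
    if "s \<noteq> 0" for s
  proof -
    have *: "poly (\<Prod>i\<in>UNIV. [:1, - c $ i:]) s = s ^ CARD('n) * (\<Prod>i\<in>UNIV. 1 / s - c $ i)"
      for c :: "real ^ 'n"
    proof -
      have "poly (\<Prod>i\<in>UNIV. [:1, - c $ i:]) s = (\<Prod>i\<in>UNIV. s * (1 / s - c $ i))"
        using that by (simp add: poly_prod right_diff_distrib)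
      then show ?thesis by (simp add: prod.distrib)
    qed
    show ?thesis unfolding * assms ..
  qed
  then have "{s. poly ((\<Prod>i\<in>UNIV. [:1, - a $ i:]) - (\<Prod>i\<in>UNIV. [:1, - b $ i:])) s = 0} \<supseteq> - {0}"
    by auto
  then have "infinite {s. poly ((\<Prod>i\<in>UNIV. [:1, - a $ i:]) - (\<Prod>i\<in>UNIV. [:1, - b $ i:])) s = 0}"
    by (meson finite_compl finite.emptyI finite_insert finite_subset infinite_UNIV_char_0)
  then have "(\<Prod>i\<in>UNIV. [:1, - a $ i:]) - (\<Prod>i\<in>UNIV. [:1, - b $ i:]) = 0"
    using poly_roots_finite by blast
  then have eq: "(\<Prod>i\<in>UNIV. [:1, (- a) $ i:]) = (\<Prod>i\<in>UNIV. [:1, (- b) $ i:])"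
    by simp
  have "elem_sym 1 (- a) = elem_sym 1 (- b)"
    unfolding coeff_prod_eq_elem_sym[symmetric] eq ..
  then show ?thesis unfolding elem_sym_1 by (simp add: sum_negf)
qed

lemma matrix_mult_diff_ldistrib:
  fixes A :: "'a::ring_1 ^ 'n ^ 'm"
  shows "A ** (B - C) = A ** B - A ** C"
  by (simp add: vec_eq_iff matrix_matrix_mult_def right_diff_distrib sum_subtractf)

lemma matrix_mult_diff_rdistrib:
  fixes A :: "'a::ring_1 ^ 'n ^ 'm"
  shows "(A - B) ** C = A ** C - B ** C"
  by (simp add: vec_eq_iff matrix_matrix_mult_def left_diff_distrib sum_subtractf)

text \<open>\<open>eigenvalues\<close> is a choice and is accessible only through the characteristic
  polynomial. Diagonalization shows that a suitable vector exists, namely the diagonal d. The chosen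
  vector has the same characteristic polynomial as d, hence the same sum, and conjugation preserves
  the trace.\<close>

lemma sum_eigenvalues:
  fixes A :: "real ^ 'n ^ 'n"
  assumes "transpose A = A"
  shows "(\<Sum>i\<in>UNIV. eigenvalues A $ i) = trace A"
proof -
  obtain P :: "real ^ 'n ^ 'n" and d :: "real ^ 'n" where P: "orthogonal_matrix P"
    and A: "A = P ** (\<chi> i j. if i = j then d $ i else 0) ** transpose P"
    using symmetric_matrix_diagonalization[OF assms] .
  let ?D = "(\<chi> i j. if i = j then d $ i else 0) :: real ^ 'n ^ 'n"
  have PP: "P ** transpose P = mat 1" "transpose P ** P = mat 1"
    using P by (simp_all add: orthogonal_matrix_def)
  have det_A: "det (mat t - A) = (\<Prod>i\<in>UNIV. t - d $ i)" for t
  proof -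
    have "mat t = P ** mat t ** transpose P"
    proof -
      have "P ** mat t = mat t ** P"
        by (simp add: vec_eq_iff matrix_matrix_mult_def mat_def if_distrib if_distribR
            mult.commute cong: if_cong)
      then have "P ** mat t ** transpose P = mat t ** (P ** transpose P)"
        by (simp add: matrix_mul_assoc)
      then show ?thesis by (simp add: PP)
    qed
    then have "mat t - A = P ** (mat t - ?D) ** transpose P"
      unfolding A by (simp add: matrix_mult_diff_ldistrib matrix_mult_diff_rdistrib)
    then have "det (mat t - A) = det (mat t - ?D) * (det P * det (transpose P))"
      by (simp add: det_mul)
    also have "det P * det (transpose P) = 1"
      by (metis PP(1) det_mul det_I)
    finally show ?thesis
      by (simp add: det_diagonal mat_def)
  qed
  then have "\<forall>t. det (mat t - A) = (\<Prod>i\<in>UNIV. t - d $ i)" by simp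
  then have "\<forall>t. det (mat t - A) = (\<Prod>i\<in>UNIV. t - eigenvalues A $ i)"
    unfolding eigenvalues_def by (rule someI)
  then have "(\<Sum>i\<in>UNIV. eigenvalues A $ i) = (\<Sum>i\<in>UNIV. d $ i)"
    by (intro sum_eq_if_prod_linear_eq) (simp flip: det_A)
  also have "\<dots> = trace ?D" by (simp add: trace_def)
  also have "\<dots> = trace (transpose P ** (P ** ?D))"
    by (simp add: matrix_mul_assoc PP)
  also have "\<dots> = trace A" unfolding A by (rule trace_mul_sym)
  finally show ?thesis .
qed

section \<open>Second derivatives\<close>

lemma has_real_derivative_along_line:
  fixes u :: "real ^ 'n \<Rightarrow> real"
  assumes "u differentiable (at (x + t *\<^sub>R v))"
  shows "((\<lambda>t. u (x + t *\<^sub>R v)) has_real_derivative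
           (\<Sum>i\<in>UNIV. v $ i * partial_deriv i u (x + t *\<^sub>R v))) (at t)"
proof -
  let ?D = "frechet_derivative u (at (x + t *\<^sub>R v))"
  have D: "(u has_derivative ?D) (at (x + t *\<^sub>R v))"
    using assms frechet_derivative_works by blast
  then interpret bounded_linear ?D
    by (rule has_derivative_bounded_linear)
  have "?D v = ?D (\<Sum>i\<in>UNIV. v $ i *\<^sub>R axis i 1)"
    by (simp flip: scalar_mult_eq_scaleR add: basis_expansion)
  also have "\<dots> = (\<Sum>i\<in>UNIV. v $ i * partial_deriv i u (x + t *\<^sub>R v))"
    by (simp add: sum scaleR partial_deriv_def)
  finally have Dv: "?D v = (\<Sum>i\<in>UNIV. v $ i * partial_deriv i u (x + t *\<^sub>R v))" .
  have "((\<lambda>t. x + t *\<^sub>R v) has_derivative (\<lambda>s. s *\<^sub>R v)) (at t)"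
    by (auto intro!: derivative_eq_intros)
  from has_derivative_compose[OF this D]
  have "((\<lambda>t. u (x + t *\<^sub>R v)) has_derivative (\<lambda>s. s * ?D v)) (at t)"
    by (simp add: scaleR)
  then show ?thesis
    by (simp add: has_field_derivative_def Dv mult.commute[of _ "sum _ _"])
qed

lemma has_real_derivative_along_axis:
  fixes u :: "real ^ 'n \<Rightarrow> real"
  assumes "u differentiable (at (x + t *\<^sub>R axis i 1))"
  shows "((\<lambda>t. u (x + t *\<^sub>R axis i 1)) has_real_derivative
           partial_deriv i u (x + t *\<^sub>R axis i 1)) (at t)"
  using has_real_derivative_along_line[OF assms]
  by (simp add: axis_def if_distrib[of "\<lambda>x. x * _"] cong: if_cong)

lemma second_difference_eq:
  fixes u :: "real ^ 'n \<Rightarrow> real"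
  assumes du: "\<And>x. u differentiable (at x)" and dui: "\<And>x. partial_deriv i u differentiable (at x)"
    and "h > 0"
  shows "\<exists>s t. 0 < s \<and> s < h \<and> 0 < t \<and> t < h \<and>
    u (x + h *\<^sub>R axis i 1 + h *\<^sub>R axis j 1) - u (x + h *\<^sub>R axis i 1)
      - (u (x + h *\<^sub>R axis j 1) - u x)
    = h\<^sup>2 * partial_deriv j (partial_deriv i u) (x + s *\<^sub>R axis i 1 + t *\<^sub>R axis j 1)"
proof -
  \<comment> \<open>The increment of this function over [0, h] is the second difference. The mean
    value theorem in direction i produces a difference of first partials, to which it is applied
    again in direction j.\<close>
  let ?\<phi> = "\<lambda>s. u ((x + h *\<^sub>R axis j 1) + s *\<^sub>R axis i 1) - u (x + s *\<^sub>R axis i 1)"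
  obtain s where s: "0 < s" "s < h" and eq1: "?\<phi> h - ?\<phi> 0 = (h - 0) *
      (partial_deriv i u ((x + h *\<^sub>R axis j 1) + s *\<^sub>R axis i 1) - partial_deriv i u (x + s *\<^sub>R axis i 1))"
    using MVT2[OF \<open>h > 0\<close>, of ?\<phi> "\<lambda>s. partial_deriv i u ((x + h *\<^sub>R axis j 1) + s *\<^sub>R axis i 1)
        - partial_deriv i u (x + s *\<^sub>R axis i 1)"]
      DERIV_diff[OF has_real_derivative_along_axis[OF du] has_real_derivative_along_axis[OF du]]
    by blast
  let ?\<psi> = "\<lambda>t. partial_deriv i u ((x + s *\<^sub>R axis i 1) + t *\<^sub>R axis j 1)"
  obtain t where t: "0 < t" "t < h" and eq2: "?\<psi> h - ?\<psi> 0 = (h - 0) *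
      partial_deriv j (partial_deriv i u) ((x + s *\<^sub>R axis i 1) + t *\<^sub>R axis j 1)"
    using MVT2[OF \<open>h > 0\<close>, of ?\<psi>
        "\<lambda>t. partial_deriv j (partial_deriv i u) ((x + s *\<^sub>R axis i 1) + t *\<^sub>R axis j 1)"] has_real_derivative_along_axis[OF dui] by blast
  have "?\<phi> h - ?\<phi> 0 = h * (?\<psi> h - ?\<psi> 0)"
    using eq1 by (simp add: add_ac)
  with eq2 have "?\<phi> h - ?\<phi> 0
      = h\<^sup>2 * partial_deriv j (partial_deriv i u) (x + s *\<^sub>R axis i 1 + t *\<^sub>R axis j 1)"
    by (simp add: power2_eq_square)
  with s t show ?thesis
    by (intro exI[of _ s] exI[of _ t]) (simp add: add_ac)
qed

lemma C_diff_continuous: "C_diff m u \<Longrightarrow> continuous_on UNIV u"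
  by (cases m) (auto simp: differentiable_imp_continuous_on differentiable_on_def)

lemma C_diff_decrease: "C_diff (Suc m) u \<Longrightarrow> C_diff m u"
proof (induction m arbitrary: u)
  case 0
  then show ?case using C_diff_continuous[OF 0] by simp
qed simp

text \<open>The second difference is symmetric in i and j. Divided by h^2 it converges to either
  mixed derivative, by continuity of the second partials, so the two limits coincide.\<close>

lemma partial_deriv_commute:
  fixes u :: "real ^ 'n \<Rightarrow> real"
  assumes "C_diff 2 u"
  shows "partial_deriv j (partial_deriv i u) x = partial_deriv i (partial_deriv j u) x"
proof -
  have du: "\<And>x. u differentiable (at x)" and dui: "\<And>i x. partial_deriv i u differentiable (at x)"
    and cont: "\<And>i j. continuous_on UNIV (partial_deriv j (partial_deriv i u))"
    using assms by (simp_all add: numeral_2_eq_2)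
  define h where "h n = inverse (real (Suc n))" for n
  have h: "h n > 0" for n by (simp add: h_def)
  have h0: "h \<longlonglongrightarrow> 0" unfolding h_def by (rule LIMSEQ_inverse_real_of_nat)
  let ?L = "\<lambda>i j n. (u (x + h n *\<^sub>R axis i 1 + h n *\<^sub>R axis j 1) - u (x + h n *\<^sub>R axis i 1)
      - (u (x + h n *\<^sub>R axis j 1) - u x)) / (h n)\<^sup>2"
  have lim: "?L i j \<longlonglongrightarrow> partial_deriv j (partial_deriv i u) x" for i j
  proof -
    have "\<exists>s t. 0 < s \<and> s < h n \<and> 0 < t \<and> t < h n \<and>
        ?L i j n = partial_deriv j (partial_deriv i u) (x + s *\<^sub>R axis i 1 + t *\<^sub>R axis j 1)" for n
    proof -
      obtain s t where "0 < s" "s < h n" "0 < t" "t < h n"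
        and "u (x + h n *\<^sub>R axis i 1 + h n *\<^sub>R axis j 1) - u (x + h n *\<^sub>R axis i 1)
            - (u (x + h n *\<^sub>R axis j 1) - u x)
          = (h n)\<^sup>2 * partial_deriv j (partial_deriv i u) (x + s *\<^sub>R axis i 1 + t *\<^sub>R axis j 1)"
        using second_difference_eq[OF du dui h[of n], where x = x and i = i and j = j] by blast
      then show ?thesis
        using h[of n] by (intro exI[of _ s] exI[of _ t]) simp
    qed
    then obtain s t where st: "\<And>n. 0 < s n" "\<And>n. s n < h n" "\<And>n. 0 < t n" "\<And>n. t n < h n"
      and L: "\<And>n. ?L i j n = partial_deriv j (partial_deriv i u) (x + s n *\<^sub>R axis i 1 + t n *\<^sub>R axis j 1)"
      by metis
    have "s \<longlonglongrightarrow> 0" "t \<longlonglongrightarrow> 0"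
      using st by (auto intro!: tendsto_sandwich[OF _ _ tendsto_const h0] always_eventually less_imp_le)
    then have "(\<lambda>n. x + s n *\<^sub>R axis i 1 + t n *\<^sub>R axis j 1) \<longlonglongrightarrow> x + 0 *\<^sub>R axis i 1 + 0 *\<^sub>R axis j 1"
      by (intro tendsto_intros)
    then have "(\<lambda>n. partial_deriv j (partial_deriv i u) (x + s n *\<^sub>R axis i 1 + t n *\<^sub>R axis j 1))
        \<longlonglongrightarrow> partial_deriv j (partial_deriv i u) x"
      by (intro isCont_tendsto_compose[of x "partial_deriv j (partial_deriv i u)"])
        (use cont[of j i] continuous_on_eq_continuous_at[OF open_UNIV] in auto)
    then show ?thesis by (simp add: L)
  qed
  have "?L i j = ?L j i" by (simp add: fun_eq_iff algebra_simps)
  then have "?L i j \<longlonglongrightarrow> partial_deriv i (partial_deriv j u) x"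
    using lim[of j i] by simp
  with lim[of i j] show ?thesis
    by (rule LIMSEQ_unique)
qed

text \<open>Finite-difference form of the fact that the Hessian of sqrt (1 + |x|^2) is at most the
  identity. It spares differentiating the comparison function.\<close>

lemma second_difference_sqrt_le:
  fixes a b :: "'a::real_inner"
  shows "sqrt (1 + (norm (a + b))\<^sup>2) + sqrt (1 + (norm (a - b))\<^sup>2) - 2 * sqrt (1 + (norm a)\<^sup>2) \<le> (norm b)\<^sup>2"
proof -
  define S where "S = sqrt (1 + (norm a)\<^sup>2)"
  define P where "P = sqrt (1 + (norm (a + b))\<^sup>2)"
  define M where "M = sqrt (1 + (norm (a - b))\<^sup>2)"
  have sq: "S\<^sup>2 = 1 + (norm a)\<^sup>2" "P\<^sup>2 = 1 + (norm (a + b))\<^sup>2" "M\<^sup>2 = 1 + (norm (a - b))\<^sup>2"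
    by (simp_all add: S_def P_def M_def)
  have S: "S \<ge> 1" by (simp add: S_def)
  \<comment> \<open>The parallelogram law.\<close>
  have par: "P\<^sup>2 + M\<^sup>2 = 2 * S\<^sup>2 + 2 * (norm b)\<^sup>2"
    unfolding sq by (simp add: power2_norm_eq_inner inner_add_left inner_add_right inner_diff_left inner_diff_right)
  have "(P + M)\<^sup>2 \<le> 2 * (P\<^sup>2 + M\<^sup>2)"
    using zero_le_power2[of "P - M"] by (simp add: power2_eq_square algebra_simps)
  also have "\<dots> = 4 * S\<^sup>2 + 4 * (1 * (norm b)\<^sup>2)"
    unfolding par by simp
  \<comment> \<open>The factor S is inserted using S >= 1, and the last term completes the
    square.\<close>
  also have "\<dots> \<le> 4 * S\<^sup>2 + 4 * (S * (norm b)\<^sup>2) + ((norm b)\<^sup>2)\<^sup>2"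
    using S by (intro add_increasing2 add_left_mono mult_left_mono mult_right_mono) auto
  also have "\<dots> = (2 * S + (norm b)\<^sup>2)\<^sup>2"
    by (simp add: power2_sum power_mult_distrib)
  finally have "P + M \<le> 2 * S + (norm b)\<^sup>2"
    by (rule power2_le_imp_le) (use S in auto)
  then show ?thesis by (simp add: S_def P_def M_def)
qed

text \<open>Let F be the second difference minus c t^2. Then F'(0) = 0 and F' has derivative 2 (D -
  c) at 0. If D > c, then F' is positive just to the right of 0, so F becomes positive there. Only
  differentiability of f' at 0 enters, so no Taylor expansion is needed.\<close>

lemma second_derivative_le_if_second_difference_le:
  fixes f :: "real \<Rightarrow> real"
  assumes f': "\<And>t. (f has_real_derivative f' t) (at t)" and f'': "(f' has_real_derivative D) (at 0)"
    and le: "\<And>t. f t + f (- t) - 2 * f 0 \<le> c * t\<^sup>2"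
  shows "D \<le> c"
proof (rule ccontr)
  assume "\<not> D \<le> c"
  define F where "F t = f t + f (- t) - 2 * f 0 - c * t\<^sup>2" for t
  define F' where "F' t = f' t - f' (- t) - 2 * c * t" for t
  have dF: "(F has_real_derivative F' t) (at t)" for t
    unfolding F_def F'_def
    by (auto intro!: derivative_eq_intros f' DERIV_chain2[OF f'])
  have "((\<lambda>t. f' (- t)) has_real_derivative D * (- 1)) (at 0)"
    by (rule DERIV_chain2[where f = f']) (use f'' in \<open>auto intro!: derivative_eq_intros\<close>)
  then have "(F' has_real_derivative 2 * D - 2 * c) (at 0)"
    unfolding F'_def by (auto intro!: derivative_eq_intros f'')
  from DERIV_pos_inc_right[OF this] \<open>\<not> D \<le> c\<close>
  obtain d where d: "d > 0" "\<And>h. h > 0 \<Longrightarrow> h < d \<Longrightarrow> F' h > F' 0"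
    by auto
  obtain s where s: "0 < s" "s < d / 2" "F (d / 2) - F 0 = (d / 2 - 0) * F' s"
    using MVT2[of 0 "d / 2" F F'] dF d(1) by auto
  have "F' s > 0" using d(2)[of s] s d(1) by (simp add: F'_def)
  with d(1) have "0 < d / 2 * F' s" by simp
  with s(3) have "F (d / 2) > F 0" by simp
  moreover have "F 0 = 0" by (simp add: F_def)
  moreover have "F (d / 2) \<le> 0" using le[of "d / 2"] by (simp add: F_def)
  ultimately show False by simp
qed

lemma hess_quadratic_form_le:
  fixes u :: "real ^ 'n \<Rightarrow> real"
  assumes u: "C_diff 2 u" and le: "\<And>y. u (x + y) + u (x - y) - 2 * u x \<le> c * (norm y)\<^sup>2"
  shows "v \<bullet> (hess u x *v v) \<le> c * (norm v)\<^sup>2"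
proof -
  have du: "\<And>x. u differentiable (at x)" and dui: "\<And>i x. partial_deriv i u differentiable (at x)"
    using u by (simp_all add: numeral_2_eq_2)
  define f' where "f' t = (\<Sum>i\<in>UNIV. v $ i * partial_deriv i u (x + t *\<^sub>R v))" for t
  have "((\<lambda>t. u (x + t *\<^sub>R v)) has_real_derivative f' t) (at t)" for t
    unfolding f'_def by (rule has_real_derivative_along_line[OF du])
  moreover have "(f' has_real_derivative v \<bullet> (hess u x *v v)) (at 0)"
  proof -
    have "(f' has_real_derivative (\<Sum>i\<in>UNIV. v $ i *
        (\<Sum>j\<in>UNIV. v $ j * partial_deriv j (partial_deriv i u) (x + 0 *\<^sub>R v)))) (at 0)"
      unfolding f'_def by (intro DERIV_sum DERIV_cmult has_real_derivative_along_line dui)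
    then show ?thesis
      by (simp add: inner_vec_def matrix_vector_mult_def hess_def mult.commute)
  qed
  moreover have "u (x + t *\<^sub>R v) + u (x + (- t) *\<^sub>R v) - 2 * u (x + 0 *\<^sub>R v) \<le> c * (norm v)\<^sup>2 * t\<^sup>2" for t
    using le[of "t *\<^sub>R v"] by (simp add: power_mult_distrib mult_ac)
  ultimately show ?thesis
    by (rule second_derivative_le_if_second_difference_le)
qed

section \<open>The curvature matrix\<close>

lemma transpose_curvature_matrix:
  assumes "transpose H = H"
  shows "transpose (curvature_matrix p H) = curvature_matrix p H"
proof -
  have "H $ i $ j = H $ j $ i" for i j
    using assms by (simp add: vec_eq_iff transpose_def)
  then show ?thesis
    by (simp add: curvature_matrix_def Let_def transpose_def vec_eq_iff)
       (simp add: algebra_simps)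
qed

text \<open>\<open>v i\<close> is the i-th column of M = I - p p^T / (w (1 + w)), and the curvature
  matrix is M H M / w. The diagonal is enough because only the trace gets estimated.\<close>

lemma curvature_matrix_diag:
  fixes p :: "real ^ 'n"
  defines "w \<equiv> sqrt (1 + (norm p)\<^sup>2)"
  assumes H: "transpose H = H"
  defines "v \<equiv> \<lambda>i. axis i 1 - (p $ i / (w * (1 + w))) *\<^sub>R p"
  shows "curvature_matrix p H $ i $ i = (v i \<bullet> (H *v v i)) / w"
proof -
  define a where "a = p $ i / (w * (1 + w))"
  have sym: "x \<bullet> (H *v y) = y \<bullet> (H *v x)" for x y
    using H by (metis dot_lmul_matrix inner_commute transpose_matrix_vector)
  have v: "v i = axis i 1 - a *\<^sub>R p"
    by (simp add: v_def a_def)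
  have 1: "axis i 1 \<bullet> (H *v axis i 1) = H $ i $ i"
    by (simp add: inner_axis' matrix_vector_mult_basis column_def)
  have 2: "p \<bullet> (H *v axis i 1) = (\<Sum>m\<in>UNIV. p $ m * H $ m $ i)"
    by (simp add: matrix_vector_mult_basis column_def inner_vec_def)
  have 3: "p \<bullet> (H *v p) = (\<Sum>m\<in>UNIV. \<Sum>l\<in>UNIV. p $ m * p $ l * H $ m $ l)"
    by (simp add: inner_vec_def matrix_vector_mult_def sum_distrib_left mult_ac)
  have "v i \<bullet> (H *v v i) = H $ i $ i - 2 * a * (p \<bullet> (H *v axis i 1)) + a\<^sup>2 * (p \<bullet> (H *v p))"
    using sym[of "axis i 1" p]
    unfolding v
    by (simp add: matrix_vector_mult_diff_distrib matrix_vector_mult_scaleR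
        inner_diff_left inner_diff_right 1 power2_eq_square algebra_simps)
  also have "\<dots> = H $ i $ i
         - (\<Sum>m\<in>UNIV. p $ i * p $ m * H $ m $ i) / (w * (1 + w))
         - (\<Sum>m\<in>UNIV. p $ i * p $ m * H $ m $ i) / (w * (1 + w))
         + (\<Sum>m\<in>UNIV. \<Sum>l\<in>UNIV. p $ i * p $ i * p $ m * p $ l * H $ m $ l)
             / (w\<^sup>2 * (1 + w)\<^sup>2)"
  proof -
    have "(\<Sum>m\<in>UNIV. p $ i * p $ m * H $ m $ i) / (w * (1 + w)) = a * (p \<bullet> (H *v axis i 1))"
      unfolding 2 a_def by (simp add: sum_distrib_left sum_divide_distrib mult_ac)
    moreover have "(\<Sum>m\<in>UNIV. \<Sum>l\<in>UNIV. p $ i * p $ i * p $ m * p $ l * H $ m $ l)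
        / (w\<^sup>2 * (1 + w)\<^sup>2) = a\<^sup>2 * (p \<bullet> (H *v p))"
      unfolding 3 a_def
      by (simp add: sum_distrib_left mult_ac power_divide power_mult_distrib power2_eq_square
          sum_divide_distrib)
    ultimately show ?thesis by simp
  qed
  finally show ?thesis
    by (simp add: curvature_matrix_def Let_def w_def)
qed

lemma trace_curvature_matrix_le:
  fixes p :: "real ^ 'n"
  assumes H: "transpose H = H" and upper: "\<And>v. v \<bullet> (H *v v) \<le> c * (norm v)\<^sup>2" and "c \<ge> 0"
  shows "trace (curvature_matrix p H) \<le> 4 * real CARD('n) * c / sqrt (1 + (norm p)\<^sup>2)"
proof -
  define w where "w = sqrt (1 + (norm p)\<^sup>2)"
  define v where "v i = axis i 1 - (p $ i / (w * (1 + w))) *\<^sub>R p" for i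
  have w: "w \<ge> 1" "norm p \<le> w"
    by (auto simp: w_def intro: real_le_rsqrt)
  have "curvature_matrix p H $ i $ i \<le> 4 * c / w" for i
  proof -
    \<comment> \<open>The correction to the unit vector has norm at most |p|^2 / (w (1 + w)), hence
      at most 1. The square of the resulting bound 2 is the factor 4 in the estimate.\<close>
    have "norm (v i) \<le> norm (axis i 1 :: real ^ 'n) + norm ((p $ i / (w * (1 + w))) *\<^sub>R p)"
      unfolding v_def by (rule norm_triangle_ineq4)
    also have "norm ((p $ i / (w * (1 + w))) *\<^sub>R p) = \<bar>p $ i\<bar> * norm p / (w * (1 + w))"
      using w by simp
    also have "\<dots> \<le> w * w / (w * (1 + w))"
      using w component_le_norm_cart[of p i]
      by (intro divide_right_mono mult_mono) auto
    also have "\<dots> \<le> 1"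
    proof -
      have "0 < w * (1 + w)" using w by (intro mult_pos_pos) auto
      then show ?thesis using w by (simp add: divide_le_eq_1_pos algebra_simps)
    qed
    finally have "norm (v i) \<le> 2" by simp
    then have "(norm (v i))\<^sup>2 \<le> 2\<^sup>2" by (rule power_mono) simp
    then have "v i \<bullet> (H *v v i) \<le> c * 4"
      using upper[of "v i"] mult_left_mono[of "(norm (v i))\<^sup>2" 4 c] \<open>c \<ge> 0\<close> by simp
    moreover have "curvature_matrix p H $ i $ i = (v i \<bullet> (H *v v i)) / w"
      unfolding v_def w_def by (rule curvature_matrix_diag[OF H])
    ultimately show ?thesis using w by (simp add: divide_right_mono mult.commute)
  qed
  then have "trace (curvature_matrix p H) \<le> (\<Sum>i\<in>(UNIV :: 'n set). 4 * c / w)"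
    unfolding trace_def by (intro sum_mono) auto
  then show ?thesis by (simp add: w_def mult_ac)
qed

section \<open>Maximum principle\<close>

lemma ex_global_max_sublinear:
  fixes u :: "'a::euclidean_space \<Rightarrow> real"
  assumes cont: "continuous_on UNIV u" and o: "u \<in> o[at_infinity](\<lambda>x. norm x)" and "\<epsilon> > 0"
  obtains x where "\<And>y. u y - \<epsilon> * sqrt (1 + (norm y)\<^sup>2) \<le> u x - \<epsilon> * sqrt (1 + (norm x)\<^sup>2)"
proof -
  define F where "F y = u y - \<epsilon> * sqrt (1 + (norm y)\<^sup>2)" for y
  have "eventually (\<lambda>y. norm (u y) \<le> (\<epsilon> / 2) * norm (norm y)) at_infinity"
    using landau_o.smallD[OF o, of "\<epsilon> / 2"] \<open>\<epsilon> > 0\<close> by simp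
  then obtain R where R: "\<And>y. norm y \<ge> R \<Longrightarrow> \<bar>u y\<bar> \<le> (\<epsilon> / 2) * norm y"
    by (auto simp: eventually_at_infinity)
  \<comment> \<open>Beyond R the growth of u uses up at most half of the penalty, so F y <=
    -(\<epsilon>/2) |y|. This is below F 0 once |y| >= -2 F 0 / \<epsilon>. The 0 in the maximum
    keeps the origin inside the ball, so the maximum over the ball is at least F 0.\<close>
  define r where "r = max 0 (max R (- 2 * F 0 / \<epsilon>))"
  have "continuous_on (cball 0 r) F"
    unfolding F_def by (intro continuous_intros continuous_on_subset[OF cont]) auto
  then obtain x where x: "x \<in> cball 0 r" "\<And>y. y \<in> cball 0 r \<Longrightarrow> F y \<le> F x"
    using continuous_attains_sup[of "cball 0 r" F] by (auto simp: r_def)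
  have "F y \<le> F x" for y
  proof (cases "y \<in> cball 0 r")
    case False
    then have y: "norm y \<ge> R" "norm y \<ge> - 2 * F 0 / \<epsilon>" by (auto simp: r_def)
    have "norm y \<le> sqrt (1 + (norm y)\<^sup>2)" by (intro real_le_rsqrt) simp
    then have "F y \<le> (\<epsilon> / 2) * norm y - \<epsilon> * norm y"
      unfolding F_def using R[OF y(1)] \<open>\<epsilon> > 0\<close> by (intro diff_mono mult_left_mono) auto
    also have "\<dots> \<le> F 0" using y(2) \<open>\<epsilon> > 0\<close> by (simp add: field_simps)
    also have "\<dots> \<le> F x" by (intro x(2)) (simp add: r_def)
    finally show ?thesis .
  qed (use x in auto)
  then show ?thesis by (intro that[of x]) (simp add: F_def)
qed

theorem theorem3p6:
  fixes k :: nat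
  assumes "k \<le> CARD('n::finite) - 1"
  shows "\<not> (\<exists>u :: real ^ 'n \<Rightarrow> real.
            C_diff 3 u \<and>
            (\<forall>x. Q_op k (grad u x) (hess u x) = 1 / sqrt (1 + (norm (grad u x))\<^sup>2)) \<and>
            (\<forall>x. principal_curvatures (grad u x) (hess u x) \<in> Gamma_cone (k + 1)) \<and>
            u \<in> o[at_infinity](\<lambda>x. norm x))"
proof
  assume "\<exists>u :: real ^ 'n \<Rightarrow> real.
            C_diff 3 u \<and>
            (\<forall>x. Q_op k (grad u x) (hess u x) = 1 / sqrt (1 + (norm (grad u x))\<^sup>2)) \<and>
            (\<forall>x. principal_curvatures (grad u x) (hess u x) \<in> Gamma_cone (k + 1)) \<and>
            u \<in> o[at_infinity](\<lambda>x. norm x)"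
  then obtain u :: "real ^ 'n \<Rightarrow> real" where "C_diff 3 u"
    and eq: "\<And>x. Q_op k (grad u x) (hess u x) = 1 / sqrt (1 + (norm (grad u x))\<^sup>2)"
    and cone: "\<And>x. principal_curvatures (grad u x) (hess u x) \<in> Gamma_cone (k + 1)"
    and o: "u \<in> o[at_infinity](\<lambda>x. norm x)"
    by blast
  have C2: "C_diff 2 u"
    using C_diff_decrease[of 2 u] \<open>C_diff 3 u\<close> by simp
  \<comment> \<open>With n = \<open>CARD('n)\<close> this makes 4 n \<epsilon> = 1/2, so the trace
    bound becomes 1 / (2 w), half of the value 1 / w prescribed for Q_k.\<close>
  define \<epsilon> where "\<epsilon> = 1 / (8 * real CARD('n))"
  have "\<epsilon> > 0" by (simp add: \<epsilon>_def)
  obtain x where x: "\<And>y. u y - \<epsilon> * sqrt (1 + (norm y)\<^sup>2) \<le> u x - \<epsilon> * sqrt (1 + (norm x)\<^sup>2)"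
    using ex_global_max_sublinear[OF C_diff_continuous[OF C2] o \<open>\<epsilon> > 0\<close>] by blast
  have second_diff: "u (x + y) + u (x - y) - 2 * u x \<le> \<epsilon> * (norm y)\<^sup>2" for y
  proof -
    \<comment> \<open>Adding the maximality inequalities at x + y and x - y bounds the second
      difference of u by that of the penalty.\<close>
    have "u (x + y) + u (x - y) - 2 * u x \<le>
        \<epsilon> * (sqrt (1 + (norm (x + y))\<^sup>2) + sqrt (1 + (norm (x - y))\<^sup>2) - 2 * sqrt (1 + (norm x)\<^sup>2))"
      using x[of "x + y"] x[of "x - y"] by (simp add: algebra_simps)
    also have "\<dots> \<le> \<epsilon> * (norm y)\<^sup>2"
      using \<open>\<epsilon> > 0\<close> by (intro mult_left_mono second_difference_sqrt_le) auto
    finally show ?thesis .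
  qed
  define w where "w = sqrt (1 + (norm (grad u x))\<^sup>2)"
  have "w > 0" unfolding w_def by (intro real_sqrt_gt_zero add_pos_nonneg) auto
  have sym: "transpose (hess u x) = hess u x"
    by (simp add: transpose_def hess_def vec_eq_iff partial_deriv_commute[OF C2])
  have "1 / w = Q_quot k (principal_curvatures (grad u x) (hess u x))"
    using eq[of x] by (simp add: Q_op_def w_def)
  also have "\<dots> \<le> (\<Sum>i\<in>UNIV. principal_curvatures (grad u x) (hess u x) $ i)"
    by (rule Q_quot_le_sum[OF cone])
  also have "\<dots> = trace (curvature_matrix (grad u x) (hess u x))"
    unfolding principal_curvatures_def
    by (rule sum_eigenvalues[OF transpose_curvature_matrix[OF sym]])
  also have "\<dots> \<le> 4 * real CARD('n) * \<epsilon> / w"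
    unfolding w_def using \<open>\<epsilon> > 0\<close>
    by (intro trace_curvature_matrix_le sym hess_quadratic_form_le[OF C2 second_diff]) auto
  also have "\<dots> = 1 / 2 / w" by (simp add: \<epsilon>_def)
  finally show False using \<open>w > 0\<close> by (simp add: field_simps)
qed

end
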